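(* Let $C\subset[0,1]$ be the middle third Cantor set, let $C\times C\subset\mathbb{R}^2$ be its Cartesian product with itself, and let $s=\dim_H(C\times C)=\log_3 4$. Then the $s$-dimensional Hausdorff measure of $C\times C$ satisfies $$H^s(C\times C)\le 1.504975.$$
   Context: The middle third Cantor set $C$ is the unique nonempty compact set with $C=f_1(C)\cup f_2(C)$, where $f_1(x)=x/3$ and $f_2(x)=(x+2)/3$. The plane $\mathbb{R}^2$ carries the Euclidean metric and $|U|$ denotes the diameter of a set $U$. Hausdorff measure is taken without any normalizing constant: for $\delta>0$, $H^s_\delta(E)=\inf\sum_{i=1}^\infty |U_i|^s$, the infimum being over all countable covers $E\subset\bigcup_i U_i$ with $0<|U_i|\le\delta$, and $H^s(E)=\lim_{\delta\to0^+}H^s_\delta(E)$. *)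

theory Defs
  imports "HOL-Analysis.Analysis"
begin

definition cantor_set :: "real set" where
  "cantor_set =
    (THE C. C \<noteq> {} \<and> compact C \<and>
       C = (\<lambda>x. x / 3) ` C \<union> (\<lambda>x. (x + 2) / 3) ` C)"

(* The definite description above is well defined. *)

lemma cantor_equation_subset:
  fixes A B :: "real set"
  assumes A: "compact A" "A = (\<lambda>x. x / 3) ` A \<union> (\<lambda>x. (x + 2) / 3) ` A"
    and B: "B \<noteq> {}" "compact B" "B = (\<lambda>x. x / 3) ` B \<union> (\<lambda>x. (x + 2) / 3) ` B"
  shows "A \<subseteq> B"
proof (cases "A = {}")
  case False
  have "continuous_on A (\<lambda>x. infdist x B)" by (intro continuous_intros)
  then obtain a where a: "a \<in> A" "\<And>x. x \<in> A \<Longrightarrow> infdist x B \<le> infdist a B"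
    using continuous_attains_sup[OF A(1) False] by blast
  have "a \<in> (\<lambda>x. x / 3) ` A \<union> (\<lambda>x. (x + 2) / 3) ` A" using a(1) A(2) by blast
  then obtain a' where a': "a' \<in> A" "a = a' / 3 \<or> a = (a' + 2) / 3" by auto
  obtain b where b: "b \<in> B" "infdist a' B = dist a' b"
    using infdist_attains_inf[OF compact_imp_closed[OF B(2)] B(1)] by metis
  have b3: "b / 3 \<in> B" "(b + 2) / 3 \<in> B" using b(1) B(3) by blast+
  have "infdist a B \<le> dist a' b / 3"
  proof (cases "a = a' / 3")
    case True
    have "infdist a B \<le> dist a (b / 3)" using b3 by (intro infdist_le)
    also have "\<dots> = dist a' b / 3" by (simp add: True dist_real_def flip: diff_divide_distrib)
    finally show ?thesis .
  next
    case False
    then have eq: "a = (a' + 2) / 3" using a'(2) by simp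
    have "infdist a B \<le> dist a ((b + 2) / 3)" using b3 by (intro infdist_le)
    also have "\<dots> = dist a' b / 3" by (simp add: eq dist_real_def flip: diff_divide_distrib)
    finally show ?thesis .
  qed
  with b(2) a(2)[OF a'(1)] infdist_nonneg[of a B] have z: "infdist a B = 0" by linarith
  show ?thesis
  proof
    fix x assume "x \<in> A"
    then have "infdist x B = 0" using a(2)[of x] z infdist_nonneg[of x B] by simp
    then show "x \<in> B"
      using in_closed_iff_infdist_zero[OF compact_imp_closed[OF B(2)] B(1)] by simp
  qed
qed simp

lemma cantor_equation_solution:
  "\<exists>C::real set. C \<noteq> {} \<and> compact C \<and> C \<subseteq> {0..1} \<and>
     C = (\<lambda>x. x / 3) ` C \<union> (\<lambda>x. (x + 2) / 3) ` C"
proof -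
  define F :: "real set \<Rightarrow> real set"
    where "F = (\<lambda>X. (\<lambda>x. x / 3) ` X \<union> (\<lambda>x. (x + 2) / 3) ` X)"
  define G where "G = (\<lambda>X. {0..1} \<inter> F X)"
  define K where "K = gfp G"
  have mono: "mono G" unfolding G_def F_def by (intro monoI) blast
  have K: "K = {0..1} \<inter> F K" using gfp_unfold[OF mono] unfolding K_def G_def by simp
  then have K01: "K \<subseteq> {0..1}" by blast
  then have "F K \<subseteq> {0..1}" unfolding F_def by fastforce
  with K have KF: "K = F K" by blast
  have "{0} \<subseteq> K" unfolding K_def by (rule gfp_upperbound) (simp add: G_def F_def)
  then have ne: "K \<noteq> {}" by blast
  have cl01: "closure K \<subseteq> {0..1}" using K01 by (intro closure_minimal) auto
  then have cc: "compact (closure K)"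
    using bounded_subset[OF bounded_closed_interval] by (simp add: compact_eq_bounded_closed)
  have "compact (F (closure K))" unfolding F_def
    by (intro compact_Un compact_continuous_image cc continuous_intros) auto
  moreover have "K \<subseteq> F (closure K)"
    using KF closure_subset[of K] unfolding F_def by blast
  ultimately have "closure K \<subseteq> F (closure K)"
    by (simp add: closure_minimal compact_imp_closed)
  then have "closure K \<subseteq> K" using cl01 unfolding K_def
    by (intro gfp_upperbound) (auto simp: G_def K_def)
  then have "closure K = K" using closure_subset by blast
  then show ?thesis using cc ne K01 KF unfolding F_def by metis
qed

lemma cantor_set_properties:
  "cantor_set \<noteq> {} \<and> compact cantor_set \<and>
   cantor_set = (\<lambda>x. x / 3) ` cantor_set \<union> (\<lambda>x. (x + 2) / 3) ` cantor_set"
proof -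
  have "\<exists>!C::real set. C \<noteq> {} \<and> compact C \<and>
      C = (\<lambda>x. x / 3) ` C \<union> (\<lambda>x. (x + 2) / 3) ` C"
    using cantor_equation_solution cantor_equation_subset subset_antisym by (smt (verit))
  from theI'[OF this] show ?thesis unfolding cantor_set_def .
qed

lemma cantor_set_subset: "cantor_set \<subseteq> {0..1}"
  using cantor_equation_solution cantor_set_properties cantor_equation_subset
  by (metis (no_types, lifting) subset_trans)

(* The library's diameter is real-valued and meaningless on unbounded sets, so
   boundedness has to be stated separately; for unbounded U the condition
   |U| \<le> \<delta> fails. *)

definition hausdorff_covers :: "real \<Rightarrow> 'a::metric_space set \<Rightarrow> (nat \<Rightarrow> 'a set) set" where
  "hausdorff_covers \<delta> E =
    {U. E \<subseteq> (\<Union>i. U i) \<and>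
        (\<forall>i. bounded (U i) \<and> 0 < diameter (U i) \<and> diameter (U i) \<le> \<delta>)}"

definition hausdorff_premeasure :: "real \<Rightarrow> real \<Rightarrow> 'a::metric_space set \<Rightarrow> ennreal" where
  "hausdorff_premeasure s \<delta> E =
    (INF U \<in> hausdorff_covers \<delta> E. \<Sum>i. ennreal (diameter (U i) powr s))"

definition hausdorff_measure :: "real \<Rightarrow> 'a::metric_space set \<Rightarrow> ennreal" where
  "hausdorff_measure s E = Lim (at_right 0) (\<lambda>\<delta>. hausdorff_premeasure s \<delta> E)"

(* The limit exists for every s and E. *)

lemma hausdorff_premeasure_antimono:
  "\<delta> \<le> \<epsilon> \<Longrightarrow> hausdorff_premeasure s \<epsilon> E \<le> hausdorff_premeasure s \<delta> E"
  unfolding hausdorff_premeasure_def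
  by (intro INF_superset_mono) (auto simp: hausdorff_covers_def intro: order_trans)

lemma hausdorff_premeasure_tendsto_SUP:
  "((\<lambda>\<delta>. hausdorff_premeasure s \<delta> E) \<longlongrightarrow>
     (SUP \<delta>\<in>{0<..}. hausdorff_premeasure s \<delta> E)) (at_right 0)"
proof (rule order_tendstoI)
  fix a assume "a < (SUP \<delta>\<in>{0<..}. hausdorff_premeasure s \<delta> E)"
  then obtain d where d: "d > 0" "a < hausdorff_premeasure s d E" by (auto simp: less_SUP_iff)
  have "eventually (\<lambda>x. x \<in> {0<..<d}) (at_right (0::real))"
    using d(1) by (rule eventually_at_right_real)
  then show "eventually (\<lambda>x. a < hausdorff_premeasure s x E) (at_right 0)"
    by eventually_elim
      (use d(2) hausdorff_premeasure_antimono[of _ d s E] in \<open>auto intro: less_le_trans\<close>)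
next
  fix a assume a: "(SUP \<delta>\<in>{0<..}. hausdorff_premeasure s \<delta> E) < a"
  have "eventually (\<lambda>x. x \<in> {0<..<1}) (at_right (0::real))"
    by (rule eventually_at_right_real) simp
  then show "eventually (\<lambda>x. hausdorff_premeasure s x E < a) (at_right 0)"
    by eventually_elim (rule le_less_trans[OF _ a], auto intro: SUP_upper)
qed

lemma hausdorff_measure_tendsto:
  "((\<lambda>\<delta>. hausdorff_premeasure s \<delta> E) \<longlongrightarrow> hausdorff_measure s E) (at_right 0)"
  using hausdorff_premeasure_tendsto_SUP[of s E] unfolding hausdorff_measure_def
  by (metis tendsto_Lim trivial_limit_at_right_real)

(* With covers indexed by all of nat and made of sets of positive diameter, the
   value at s = 0 is infinite for every set; this does not affect the infimum. *)

definition hausdorff_dim :: "'a::metric_space set \<Rightarrow> ereal" where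
  "hausdorff_dim E = (INF s \<in> {s::real. 0 \<le> s \<and> hausdorff_measure s E = 0}. ereal s)"

end

theory Submission
  imports Defs
begin

text \<open>
  Write \<open>E = C \<times> C\<close>, and let \<open>P\<^sub>\<delta>(A)\<close> be the premeasure of \<open>A\<close> by covers of mesh \<open>\<delta>\<close>.

  \<^emph>\<open>Upper bounds.\<close> As \<open>E\<close> consists of four copies of itself scaled by \<open>1/3\<close>, subadditivity and
  scaling give \<open>P\<^bsub>\<delta>/3\<^esub>(E) \<le> (4/3\<^sup>t) P\<^sub>\<delta>(E)\<close> for the exponent \<open>t\<close>
  (\<open>cantor_square_premeasure_refine\<close>). At \<open>t = s = log\<^sub>3 4\<close> the factor is \<open>1\<close>, so the Hausdorff
  measure is at most the premeasure at any single coarse mesh; for \<open>t > s\<close> the factor is less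
  than \<open>1\<close> and the measure vanishes.

  It remains to cover \<open>E\<close> economically at mesh \<open>2\<close>; write \<open>P\<close> for \<open>P\<^sub>2\<close>. The unit square itself gives \<open>2\<^bsup>s/2\<^esup>\<close>, about
  \<open>1.5486\<close>. To do better, cut the corners of the square at \<open>l\<^sup>1\<close>-distance \<open>20/243\<close> and keep the
  octagon that remains. Two points of it differ by at most \<open>1\<close> in each coordinate and by at most
  \<open>2 - 40/243 = 1 + 203/243\<close> in the \<open>l\<^sup>1\<close>-norm, so its squared diameter is at most
  \<open>1 + (203/243)\<^sup>2\<close>. The part of \<open>E\<close> in each lost corner lies in one copy of \<open>E\<close> of ratio \<open>1/27\<close>
  and two of ratio \<open>1/243\<close>. At the exponent \<open>s\<close> these copies have premeasure at most \<open>1/64\<close> and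
  \<open>1/1024\<close> of that of \<open>E\<close>, whence
  \<open>P(E) \<le> (1 + (203/243)\<^sup>2)\<^bsup>s/2\<^esup> + (9/128) P(E)\<close>. Because \<open>P(E)\<close> is finite, this can be solved
  for \<open>P(E)\<close> and gives about \<open>1.5022\<close>; the rational bound \<open>s/2 = log\<^sub>3 2 \<le> 12/19\<close> is sharp enough
  to stay below \<open>1.504975\<close>. Cutting off only the four cells of side \<open>1/27\<close> would give
  \<open>1.5049757\<close>, which is slightly too large.

  \<^emph>\<open>Lower bound for the dimension.\<close> The four subsquares of level one have mutual distance at least
  \<open>1/3\<close>, so a set of diameter less than \<open>1/3\<close> meets only one of them. Magnifying each subsquare
  by \<open>3\<close> turns a finite cover of \<open>E\<close> by small sets into four disjoint covers by sets three times
  as large; if \<open>3\<^sup>t \<le> 4\<close>, induction on the scale of the smallest set bounds the sum of the \<open>t\<close>-th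
  powers of the diameters of a finite cover from below (\<open>cantor_square_finite_cover\<close>).
  Compactness of \<open>E\<close> carries this over to countable covers, so the measure is positive for \<open>t \<le> s\<close>.
\<close>

section \<open>Hausdorff premeasure\<close>

lemma hausdorff_measure_eq_SUP:
  "hausdorff_measure s E = (SUP \<delta>\<in>{0<..}. hausdorff_premeasure s \<delta> E)"
  using tendsto_unique[OF _ hausdorff_measure_tendsto hausdorff_premeasure_tendsto_SUP] by simp

lemma hausdorff_premeasure_mono:
  "A \<subseteq> B \<Longrightarrow> hausdorff_premeasure s \<delta> A \<le> hausdorff_premeasure s \<delta> B"
  unfolding hausdorff_premeasure_def
  by (intro INF_superset_mono) (auto simp: hausdorff_covers_def)

lemma suminf_interleave_le:
  fixes f g :: "nat \<Rightarrow> ennreal"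
  shows "(\<Sum>i. if even i then f (i div 2) else g (i div 2)) \<le> (\<Sum>i. f i) + (\<Sum>i. g i)"
    (is "(\<Sum>i. ?h i) \<le> _")
proof (rule suminf_le_const)
  fix n
  have *: "sum ?h {..<2 * m} = sum f {..<m} + sum g {..<m}" for m
    by (induction m) (auto simp: algebra_simps)
  have "sum ?h {..<n} \<le> sum ?h {..<2 * n}" by (intro sum_mono2) auto
  also have "\<dots> \<le> (\<Sum>i. f i) + (\<Sum>i. g i)"
    unfolding * by (intro add_mono sum_le_suminf) auto
  finally show "sum ?h {..<n} \<le> (\<Sum>i. f i) + (\<Sum>i. g i)" .
qed auto

lemma hausdorff_premeasure_Un:
  "hausdorff_premeasure s \<delta> (A \<union> B) \<le> hausdorff_premeasure s \<delta> A + hausdorff_premeasure s \<delta> B"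
proof (rule ennreal_le_epsilon)
  fix e :: real
  let ?S = "\<lambda>U. \<Sum>i. ennreal (diameter (U i) powr s)"
  assume fin: "hausdorff_premeasure s \<delta> A + hausdorff_premeasure s \<delta> B < top" and e: "0 < e"
  have approx: "\<exists>U\<in>hausdorff_covers \<delta> X. ?S U < hausdorff_premeasure s \<delta> X + ennreal (e / 2)"
    if "hausdorff_premeasure s \<delta> X < top" for X :: "'a set"
  proof -
    have "hausdorff_premeasure s \<delta> X + 0 < hausdorff_premeasure s \<delta> X + ennreal (e / 2)"
      using that e by (subst ennreal_add_left_cancel_less) auto
    then show ?thesis
      unfolding hausdorff_premeasure_def by (simp add: INF_less_iff)
  qed
  have "hausdorff_premeasure s \<delta> A < top" "hausdorff_premeasure s \<delta> B < top"
    by (rule le_less_trans[OF _ fin], simp add: add_increasing add_increasing2)+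
  then obtain U V where U: "U \<in> hausdorff_covers \<delta> A"
      "?S U < hausdorff_premeasure s \<delta> A + ennreal (e / 2)"
    and V: "V \<in> hausdorff_covers \<delta> B"
      "?S V < hausdorff_premeasure s \<delta> B + ennreal (e / 2)"
    using approx by meson
  define W where "W = (\<lambda>i::nat. if even i then U (i div 2) else V (i div 2))"
  have W: "U i = W (2 * i)" "V i = W (2 * i + 1)" for i by (auto simp: W_def)
  have "A \<union> B \<subseteq> (\<Union>i. W i)"
    using U(1) V(1) unfolding hausdorff_covers_def W by blast
  then have "W \<in> hausdorff_covers \<delta> (A \<union> B)"
    using U(1) V(1) unfolding hausdorff_covers_def by (auto simp: W_def)
  then have "hausdorff_premeasure s \<delta> (A \<union> B) \<le> ?S W"
    unfolding hausdorff_premeasure_def by (rule INF_lower)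
  also have "?S W = (\<Sum>i. if even i then ennreal (diameter (U (i div 2)) powr s)
      else ennreal (diameter (V (i div 2)) powr s))"
    by (intro suminf_cong) (simp add: W_def)
  also have "\<dots> \<le> ?S U + ?S V" by (rule suminf_interleave_le)
  also have "\<dots> \<le> (hausdorff_premeasure s \<delta> A + ennreal (e / 2)) +
      (hausdorff_premeasure s \<delta> B + ennreal (e / 2))"
    using U(2) V(2) by (intro add_mono) auto
  also have "\<dots> = hausdorff_premeasure s \<delta> A + hausdorff_premeasure s \<delta> B
      + (ennreal (e / 2) + ennreal (e / 2))" by (simp add: ac_simps)
  also have "ennreal (e / 2) + ennreal (e / 2) = ennreal e"
    using e by (simp flip: ennreal_plus)
  finally show "hausdorff_premeasure s \<delta> (A \<union> B) \<le>
      hausdorff_premeasure s \<delta> A + hausdorff_premeasure s \<delta> B + ennreal e" .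
qed

lemma similarity_bounded_image:
  fixes f :: "'a::metric_space \<Rightarrow> 'b::metric_space"
  assumes sim: "\<And>x y. dist (f x) (f y) = r * dist x y" and "bounded U"
  shows "bounded (f ` U)"
proof -
  obtain x e where "\<And>y. y \<in> U \<Longrightarrow> dist x y \<le> e" using \<open>bounded U\<close> unfolding bounded_def by blast
  then have "dist (f x) (f y) \<le> \<bar>r\<bar> * e" if "y \<in> U" for y
    unfolding sim using that
    by (meson abs_ge_self abs_ge_zero mult_mono zero_le_dist)
  then show ?thesis unfolding bounded_def by blast
qed

lemma similarity_diameter_image:
  fixes f :: "'a::metric_space \<Rightarrow> 'b::metric_space"
  assumes sim: "\<And>x y. dist (f x) (f y) = r * dist x y" and "r > 0" and "bounded U"
  shows "diameter (f ` U) = r * diameter U"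
proof (cases "U = {}")
  case False
  have bd: "bounded (f ` U)" using sim \<open>bounded U\<close> by (rule similarity_bounded_image)
  have "diameter (f ` U) \<le> r * diameter U"
    unfolding diameter_def using False
    using diameter_bounded_bound[OF \<open>bounded U\<close>] \<open>r > 0\<close>
    by (auto intro!: cSUP_least simp: sim diameter_def)
  moreover have "diameter U \<le> diameter (f ` U) / r"
  proof -
    have "dist x y \<le> diameter (f ` U) / r" if "x \<in> U" "y \<in> U" for x y
      using diameter_bounded_bound[OF bd, of "f x" "f y"] that \<open>r > 0\<close>
      by (simp add: sim field_simps)
    then show ?thesis
      using False by (auto simp: diameter_def[of U] intro!: cSUP_least)
  qed
  ultimately show ?thesis using \<open>r > 0\<close> by (simp add: field_simps)
qed (simp add: diameter_def)

lemma hausdorff_premeasure_similarity_image: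
  fixes f :: "'a::metric_space \<Rightarrow> 'b::metric_space"
  assumes sim: "\<And>x y. dist (f x) (f y) = r * dist x y" and "r > 0"
  shows "hausdorff_premeasure s (r * \<delta>) (f ` E) \<le> ennreal (r powr s) * hausdorff_premeasure s \<delta> E"
proof -
  define c where "c = r powr s"
  have c: "c > 0" using \<open>r > 0\<close> by (simp add: c_def)
  have "ennreal (1 / c) * hausdorff_premeasure s (r * \<delta>) (f ` E)
      \<le> hausdorff_premeasure s \<delta> E"
    unfolding hausdorff_premeasure_def[of s \<delta> E]
  proof (rule INF_greatest)
    fix U assume U: "U \<in> hausdorff_covers \<delta> E"
    have diam: "diameter (f ` U i) = r * diameter (U i)" "bounded (f ` U i)" for i
      using U similarity_diameter_image[OF sim \<open>r > 0\<close>] similarity_bounded_image[OF sim]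
      by (auto simp: hausdorff_covers_def)
    have "(\<lambda>i. f ` U i) \<in> hausdorff_covers (r * \<delta>) (f ` E)"
      using U \<open>r > 0\<close> by (fastforce simp: hausdorff_covers_def diam)
    then have "hausdorff_premeasure s (r * \<delta>) (f ` E)
        \<le> (\<Sum>i. ennreal (diameter (f ` U i) powr s))"
      unfolding hausdorff_premeasure_def by (rule INF_lower)
    also have "\<dots> = (\<Sum>i. ennreal c * ennreal (diameter (U i) powr s))"
      using U c \<open>r > 0\<close>
      by (intro suminf_cong)
        (auto simp: diam c_def powr_mult hausdorff_covers_def less_imp_le simp flip: ennreal_mult')
    also have "\<dots> = ennreal c * (\<Sum>i. ennreal (diameter (U i) powr s))" by simp
    finally have "ennreal (1 / c) * hausdorff_premeasure s (r * \<delta>) (f ` E) \<le>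
        ennreal (1 / c) * (ennreal c * (\<Sum>i. ennreal (diameter (U i) powr s)))"
      by (rule mult_left_mono) simp
    also have "\<dots> = (\<Sum>i. ennreal (diameter (U i) powr s))"
      using c by (simp flip: mult.assoc ennreal_mult')
    finally show "ennreal (1 / c) * hausdorff_premeasure s (r * \<delta>) (f ` E) \<le> \<dots>" .
  qed
  then have "ennreal c * (ennreal (1 / c) * hausdorff_premeasure s (r * \<delta>) (f ` E))
      \<le> ennreal c * hausdorff_premeasure s \<delta> E"
    by (rule mult_left_mono) simp
  then show ?thesis using c by (simp add: c_def flip: mult.assoc ennreal_mult')
qed

text \<open>
  A contraction ratio lets the mesh stay fixed; this is the form in which a set can be compared
  with smaller copies of itself.
\<close>

lemma hausdorff_premeasure_contraction_image:
  fixes f :: "'a::metric_space \<Rightarrow> 'b::metric_space"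
  assumes "\<And>x y. dist (f x) (f y) = r * dist x y" "0 < r" "r \<le> 1" "0 \<le> \<delta>"
  shows "hausdorff_premeasure s \<delta> (f ` E) \<le> ennreal (r powr s) * hausdorff_premeasure s \<delta> E"
proof -
  have "hausdorff_premeasure s \<delta> (f ` E) \<le> hausdorff_premeasure s (r * \<delta>) (f ` E)"
    using assms by (intro hausdorff_premeasure_antimono) (simp add: mult_left_le_one_le)
  also have "\<dots> \<le> ennreal (r powr s) * hausdorff_premeasure s \<delta> E"
    by (rule hausdorff_premeasure_similarity_image) fact+
  finally show ?thesis .
qed

text \<open>
  A cover is an infinite sequence of sets of positive diameter, so a cover by one set has to be
  padded. Two-point sets with geometrically decreasing diameters add an arbitrarily small amount.
\<close>

lemma hausdorff_premeasure_le_diameter: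
  fixes A :: "'a::{real_normed_vector, perfect_space} set"
  assumes "bounded A" "0 < diameter A" "diameter A \<le> \<delta>" "s > 0"
  shows "hausdorff_premeasure s \<delta> A \<le> ennreal (diameter A powr s)"
proof (rule ennreal_le_epsilon)
  fix e :: real assume e: "0 < e"
  \<comment> \<open>The padding set with index \<open>i + 1\<close> has diameter \<open>m i\<close> with \<open>m i\<^sup>s \<le> e 2\<^bsup>-i-1\<^esup>\<close>.\<close>
  define m where "m = (\<lambda>i::nat. min \<delta> ((e * (1 / 2) ^ Suc i) powr (1 / s)))"
  have m: "0 < m i" "m i \<le> \<delta>" "m i powr s \<le> e * (1 / 2) ^ Suc i" for i
  proof -
    show pos: "0 < m i" using assms e by (simp add: m_def)
    show "m i \<le> \<delta>" by (simp add: m_def)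
    have "m i powr s \<le> ((e * (1 / 2) ^ Suc i) powr (1 / s)) powr s"
      using pos \<open>s > 0\<close> by (intro powr_mono2) (auto simp: m_def)
    also have "\<dots> = e * (1 / 2) ^ Suc i"
      using e \<open>s > 0\<close> by (simp add: powr_powr)
    finally show "m i powr s \<le> e * (1 / 2) ^ Suc i" .
  qed
  have "\<exists>v. \<forall>i. norm (v i :: 'a) = m i"
    using vector_choose_size[OF less_imp_le[OF m(1)]] by (intro choice) blast
  then obtain v where v: "\<And>i. norm (v i :: 'a) = m i" by blast
  define U where "U = (\<lambda>i. case i of 0 \<Rightarrow> A | Suc i \<Rightarrow> {0, v i})"
  have diam: "diameter {0, v i} = m i" for i
  proof (rule antisym)
    show "diameter {0, v i} \<le> m i"
      using m(1)[of i] by (intro diameter_le) (auto simp: v)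
    show "m i \<le> diameter {0, v i}"
      using diameter_bounded_bound[of "{0, v i}" 0 "v i"] by (simp add: v)
  qed
  have "U \<in> hausdorff_covers \<delta> A"
    unfolding hausdorff_covers_def
  proof (intro CollectI conjI allI)
    show "A \<subseteq> (\<Union>i. U i)" unfolding U_def by (auto intro!: exI[of _ 0])
    fix i
    show "bounded (U i)" "0 < diameter (U i)" "diameter (U i) \<le> \<delta>"
      using assms m diam by (auto simp: U_def split: nat.split)
  qed
  then have "hausdorff_premeasure s \<delta> A \<le> (\<Sum>i. ennreal (diameter (U i) powr s))"
    unfolding hausdorff_premeasure_def by (rule INF_lower)
  also have "\<dots> = ennreal (diameter A powr s) + (\<Sum>i. ennreal (m i powr s))"
    by (subst suminf_offset[where i = 1]) (auto simp: U_def diam add.commute)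
  also have "(\<Sum>i. ennreal (m i powr s)) \<le> (\<Sum>i. ennreal (e * (1 / 2) ^ Suc i))"
    by (intro suminf_le ennreal_leI m(3)) auto
  also have "\<dots> = ennreal e"
    using sums_mult[OF power_half_series, of e] e by (intro suminf_ennreal_eq) auto
  finally show "hausdorff_premeasure s \<delta> A \<le> ennreal (diameter A powr s) + ennreal e"
    by simp
qed

section \<open>Self-similarity of the Cantor set and its square\<close>

lemma cantor_set_third:
  assumes "x \<in> cantor_set"
  shows "x / 3 \<in> cantor_set" "(x + 2) / 3 \<in> cantor_set"
  using assms cantor_set_properties by blast+

lemma cantor_set_cases:
  assumes "x \<in> cantor_set"
  obtains "3 * x \<in> cantor_set" "x \<le> 1 / 3" | "3 * x - 2 \<in> cantor_set" "2 / 3 \<le> x"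
proof -
  have "x \<in> (\<lambda>x. x / 3) ` cantor_set \<union> (\<lambda>x. (x + 2) / 3) ` cantor_set"
    using assms cantor_set_properties by blast
  then consider y where "y \<in> cantor_set" "x = y / 3" | y where "y \<in> cantor_set" "x = (y + 2) / 3"
    by blast
  then show thesis
  proof cases
    case 1
    have "3 * x = y" "x \<le> 1 / 3" using 1 cantor_set_subset by auto
    with 1(1) show ?thesis using that(1) by blast
  next
    case 2
    have "3 * x - 2 = y" "2 / 3 \<le> x" using 2 cantor_set_subset by auto
    with 2(1) show ?thesis using that(2) by blast
  qed
qed

text \<open>The interval \<open>[0, 2/3\<^sup>n)\<close> meets the Cantor set only in its leftmost cell of level \<open>n\<close>.\<close>

lemma cantor_set_zoom:
  assumes "x \<in> cantor_set" "x * 3 ^ n < 2"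
  shows "x * 3 ^ n \<in> cantor_set"
  using assms(2)
proof (induction n)
  case (Suc n)
  have "0 \<le> x" using assms(1) cantor_set_subset by auto
  with Suc have "x * 3 ^ n \<in> cantor_set" "x * 3 ^ n < 2 / 3"
    by (auto simp: mult.left_commute)
  then show ?case by (cases rule: cantor_set_cases) (auto simp: mult.left_commute)
qed (use assms in simp)

lemma cantor_set_reflect:
  assumes "x \<in> cantor_set"
  shows "1 - x \<in> cantor_set"
proof -
  let ?R = "(\<lambda>x. 1 - x) ` cantor_set"
  have "?R = (\<lambda>x. x / 3) ` ?R \<union> (\<lambda>x. (x + 2) / 3) ` ?R" (is "_ = ?F")
  proof (intro equalityI subsetI)
    fix y assume "y \<in> ?R"
    then obtain x where x: "x \<in> cantor_set" "y = 1 - x" by blast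
    from x(1) show "y \<in> ?F"
    proof (cases rule: cantor_set_cases)
      case 1
      then have "y = ((1 - 3 * x) + 2) / 3" using x by simp
      with 1 show ?thesis by blast
    next
      case 2
      then have "y = (1 - (3 * x - 2)) / 3" using x by (simp add: field_simps)
      with 2 show ?thesis by blast
    qed
  next
    fix y assume "y \<in> ?F"
    then obtain x where x: "x \<in> cantor_set" "y = (1 - x) / 3 \<or> y = ((1 - x) + 2) / 3" by blast
    then have "y = 1 - (x + 2) / 3 \<or> y = 1 - x / 3" by (auto simp: field_simps)
    then show "y \<in> ?R" using cantor_set_third[OF x(1)] by blast
  qed
  moreover have "compact ?R"
    using cantor_set_properties by (intro compact_continuous_image continuous_intros) auto
  ultimately have "?R \<subseteq> cantor_set"
    using cantor_set_properties by (intro cantor_equation_subset) auto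
  then show ?thesis using assms by blast
qed

lemma cantor_set_endpoints: "0 \<in> cantor_set" "1 \<in> cantor_set"
proof -
  obtain x where x: "x \<in> cantor_set" using cantor_set_properties by blast
  have "(\<lambda>n. x * (1 / 3) ^ n) \<longlonglongrightarrow> x * 0"
    by (intro tendsto_intros LIMSEQ_realpow_zero) auto
  moreover have "x * (1 / 3) ^ n \<in> cantor_set" for n
    by (induction n) (use x cantor_set_third in \<open>auto simp: mult.left_commute\<close>)
  moreover have "closed cantor_set" using cantor_set_properties compact_imp_closed by blast
  ultimately show "0 \<in> cantor_set" using closed_sequentially[of cantor_set] by fastforce
  from cantor_set_reflect[OF this] show "1 \<in> cantor_set" by simp
qed

abbreviation cantor_square :: "(real \<times> real) set" where
  "cantor_square \<equiv> cantor_set \<times> cantor_set"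

definition third_map :: "real \<times> real \<Rightarrow> real \<times> real \<Rightarrow> real \<times> real" where
  "third_map c p = (1 / 3) *\<^sub>R (c + p)"

abbreviation cell_shifts :: "(real \<times> real) set" where
  "cell_shifts \<equiv> {0, 2} \<times> {0, 2}"

lemma dist_third_map: "dist (third_map c p) (third_map c q) = (1 / 3) * dist p q"
  by (simp add: third_map_def dist_norm flip: scaleR_diff_right)

lemma third_map_in_cantor_square:
  "c \<in> cell_shifts \<Longrightarrow> p \<in> cantor_square \<Longrightarrow> third_map c p \<in> cantor_square"
  using cantor_set_third by (auto simp: third_map_def add.commute)

lemma cantor_square_subset_third_maps:
  "cantor_square \<subseteq> (\<Union>c\<in>cell_shifts. third_map c ` cantor_square)"
proof
  have one: "\<exists>c\<in>{0, 2}. \<exists>y\<in>cantor_set. x = (c + y) / 3" if "x \<in> cantor_set" for x :: real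
    using that
  proof (cases rule: cantor_set_cases)
    case 1
    then show ?thesis by (intro bexI[of _ 0] bexI[of _ "3 * x"]) auto
  next
    case 2
    then show ?thesis by (intro bexI[of _ 2] bexI[of _ "3 * x - 2"]) auto
  qed
  fix p assume "p \<in> cantor_square"
  then have "fst p \<in> cantor_set" "snd p \<in> cantor_set" by auto
  then obtain a x b y where "a \<in> {0, 2}" "x \<in> cantor_set" "fst p = (a + x) / 3"
      "b \<in> {0, 2}" "y \<in> cantor_set" "snd p = (b + y) / 3"
    using one by metis
  then have "(a, b) \<in> cell_shifts" "(x, y) \<in> cantor_square" "p = third_map (a, b) (x, y)"
    by (auto simp: third_map_def prod_eq_iff)
  then show "p \<in> (\<Union>c\<in>cell_shifts. third_map c ` cantor_square)" by blast
qed

lemma compact_cantor_square: "compact cantor_square"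
  using cantor_set_properties by (simp add: compact_Times)

lemma third_map_separated:
  assumes "c \<in> cell_shifts" "c' \<in> cell_shifts" "c \<noteq> c'" "p \<in> cantor_square" "q \<in> cantor_square"
  shows "1 / 3 \<le> dist (third_map c p) (third_map c' q)"
proof -
  have gap: "1 / 3 \<le> dist ((1 / 3) * (a + x)) ((1 / 3) * (b + y))"
    if "a \<in> {0, 2}" "b \<in> {0, 2}" "a \<noteq> b" "x \<in> {0..1}" "y \<in> {0..1}" for a b x y :: real
    using that by (auto simp: dist_real_def field_simps)
  have "fst p \<in> {0..1}" "snd p \<in> {0..1}" "fst q \<in> {0..1}" "snd q \<in> {0..1}"
    using assms(4,5) cantor_set_subset by auto
  moreover have "fst c \<noteq> fst c' \<or> snd c \<noteq> snd c'"
    using assms(3) by (simp add: prod_eq_iff)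
  moreover have "fst c \<in> {0, 2}" "snd c \<in> {0, 2}" "fst c' \<in> {0, 2}" "snd c' \<in> {0, 2}"
    using assms(1,2) by auto
  ultimately have "1 / 3 \<le> dist (fst (third_map c p)) (fst (third_map c' q)) \<or>
      1 / 3 \<le> dist (snd (third_map c p)) (snd (third_map c' q))"
    using gap[of "fst c" "fst c'" "fst p" "fst q"] gap[of "snd c" "snd c'" "snd p" "snd q"]
    unfolding third_map_def by auto
  then show ?thesis
    using dist_fst_le[of "third_map c p" "third_map c' q"]
      dist_snd_le[of "third_map c p" "third_map c' q"] by linarith
qed

section \<open>Positivity of the measure below the critical exponent\<close>

text \<open>
  The induction is on the scale of the smallest set. Once some set has size at least \<open>1/3\<close>, its
  own term suffices. Otherwise each set serves at most one of the four cells of level one, and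
  magnification by \<open>3\<close> makes the induction hypothesis available for each cell. The magnification
  costs a factor \<open>3\<^sup>t\<close>, which the four cells compensate because \<open>3\<^sup>t \<le> 4\<close>.
\<close>

lemma cantor_square_finite_cover:
  fixes U :: "'i \<Rightarrow> (real \<times> real) set"
  assumes t: "0 \<le> t" "3 powr t \<le> (4::real)"
    and "finite I" "cantor_square \<subseteq> (\<Union>i\<in>I. U i)"
    and "\<And>i. i \<in> I \<Longrightarrow> 1 / 3 ^ N \<le> d i"
    and "\<And>i x y. i \<in> I \<Longrightarrow> x \<in> U i \<Longrightarrow> y \<in> U i \<Longrightarrow> dist x y \<le> d i"
  shows "3 powr (- t) \<le> (\<Sum>i\<in>I. d i powr t)"
  using assms(3-)
proof (induction N arbitrary: I U d)
  case 0
  have "I \<noteq> {}" using "0.prems"(2) cantor_set_endpoints by auto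
  then obtain i where i: "i \<in> I" by blast
  have "3 powr (- t) \<le> (1::real) powr t" using t by (simp add: powr_minus ge_one_powr_ge_zero inverse_le_1_iff)
  also have "\<dots> \<le> d i powr t" using "0.prems"(3)[OF i] t by (intro powr_mono2) auto
  also have "\<dots> \<le> (\<Sum>i\<in>I. d i powr t)"
    using "0.prems"(1) i by (intro member_le_sum) auto
  finally show ?case .
next
  case (Suc N)
  show ?case
  proof (cases "\<exists>i\<in>I. 1 / 3 \<le> d i")
    case True
    then obtain i where i: "i \<in> I" "1 / 3 \<le> d i" by blast
    have "3 powr (- t) = (1 / 3 :: real) powr t" by (simp add: powr_minus_divide powr_divide)
    also have "\<dots> \<le> d i powr t" using i t by (intro powr_mono2) auto
    also have "\<dots> \<le> (\<Sum>i\<in>I. d i powr t)"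
      using Suc.prems(1) i by (intro member_le_sum) auto
    finally show ?thesis .
  next
    case False
    define V where "V = (\<lambda>c i. {p \<in> cantor_square. third_map c p \<in> U i})"
    define J where "J = (\<lambda>c. {i \<in> I. V c i \<noteq> {}})"
    have disj: "J c \<inter> J c' = {}" if "c \<in> cell_shifts" "c' \<in> cell_shifts" "c \<noteq> c'" for c c'
    proof (rule ccontr)
      assume "J c \<inter> J c' \<noteq> {}"
      then obtain i p q where ipq: "i \<in> I" "p \<in> cantor_square" "q \<in> cantor_square"
          "third_map c p \<in> U i" "third_map c' q \<in> U i"
        unfolding J_def V_def by blast
      then have "1 / 3 \<le> d i"
        using third_map_separated[OF that ipq(2,3)] Suc.prems(4)[OF ipq(1,4,5)] by linarith
      with False ipq(1) show False by blast
    qed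
    have cell: "3 powr (- t) \<le> 4 * (\<Sum>i\<in>J c. d i powr t)" if c: "c \<in> cell_shifts" for c
    proof -
      have "3 powr (- t) \<le> (\<Sum>i\<in>J c. (3 * d i) powr t)"
      proof (rule Suc.IH[where U = "V c"])
        show "finite (J c)" using Suc.prems(1) by (simp add: J_def)
        show "cantor_square \<subseteq> (\<Union>i\<in>J c. V c i)"
        proof
          fix p assume p: "p \<in> cantor_square"
          have "third_map c p \<in> (\<Union>i\<in>I. U i)"
            using subsetD[OF Suc.prems(2) third_map_in_cantor_square[OF c p]] .
          then obtain i where i: "i \<in> I" "third_map c p \<in> U i" by (rule UN_E)
          then have "p \<in> V c i" using p by (simp add: V_def)
          moreover from this have "i \<in> J c" using i(1) by (auto simp: J_def)
          ultimately show "p \<in> (\<Union>i\<in>J c. V c i)" by (rule UN_I[rotated])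
        qed
        show "1 / 3 ^ N \<le> 3 * d i" if "i \<in> J c" for i
          using Suc.prems(3)[of i] that by (simp add: J_def field_simps)
        show "dist x y \<le> 3 * d i" if "i \<in> J c" "x \<in> V c i" "y \<in> V c i" for i x y
          using Suc.prems(4)[of i "third_map c x" "third_map c y"] that
          by (simp add: J_def V_def dist_third_map)
      qed
      also have "\<dots> = (\<Sum>i\<in>J c. 3 powr t * d i powr t)"
      proof (rule sum.cong)
        fix i assume "i \<in> J c"
        then have "1 / 3 ^ Suc N \<le> d i" using Suc.prems(3) by (simp add: J_def)
        moreover have "0 < 1 / (3::real) ^ Suc N" by simp
        ultimately have "0 \<le> d i" by linarith
        then show "(3 * d i) powr t = 3 powr t * d i powr t" by (simp add: powr_mult)
      qed simp
      also have "\<dots> = 3 powr t * (\<Sum>i\<in>J c. d i powr t)" by (simp add: sum_distrib_left)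
      also have "\<dots> \<le> 4 * (\<Sum>i\<in>J c. d i powr t)"
        using t by (intro mult_right_mono sum_nonneg) auto
      finally show ?thesis .
    qed
    have "4 * 3 powr (- t) = (\<Sum>c\<in>cell_shifts. 3 powr (- t))" by simp
    also have "\<dots> \<le> (\<Sum>c\<in>cell_shifts. 4 * (\<Sum>i\<in>J c. d i powr t))" by (intro sum_mono cell)
    also have "\<dots> = 4 * (\<Sum>c\<in>cell_shifts. \<Sum>i\<in>J c. d i powr t)"
      by (rule sum_distrib_left[symmetric])
    also have "(\<Sum>c\<in>cell_shifts. \<Sum>i\<in>J c. d i powr t) = (\<Sum>i\<in>(\<Union>c\<in>cell_shifts. J c). d i powr t)"
      using Suc.prems(1) disj by (intro sum.UNION_disjoint[symmetric]) (auto simp: J_def)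
    also have "\<dots> \<le> (\<Sum>i\<in>I. d i powr t)"
      using Suc.prems(1) by (intro sum_mono2) (auto simp: J_def)
    finally show ?thesis by simp
  qed
qed

text \<open>
  Each set of a countable cover is replaced by an open ball of twice its diameter as radius. This
  costs a factor \<open>4\<^sup>t\<close> and makes finitely many sets suffice.
\<close>

lemma cantor_square_premeasure_ge:
  assumes t: "0 \<le> t" "3 powr t \<le> (4::real)"
  shows "ennreal (12 powr (- t)) \<le> hausdorff_premeasure t \<delta> cantor_square"
  unfolding hausdorff_premeasure_def
proof (rule INF_greatest)
  fix U assume U: "U \<in> hausdorff_covers \<delta> cantor_square"
  define d where "d = (\<lambda>i. diameter (U i))"
  have d: "0 < d i" for i using U by (simp add: hausdorff_covers_def d_def)
  have "U i \<noteq> {}" for i using d[of i] by (auto simp: d_def)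
  then have "\<exists>x. \<forall>i. x i \<in> U i" by (intro choice) blast
  then obtain x where x: "\<And>i. x i \<in> U i" by blast
  have "U i \<subseteq> ball (x i) (2 * d i)" for i
  proof
    fix y assume "y \<in> U i"
    then have "dist (x i) y \<le> d i"
      using diameter_bounded_bound[of "U i"] U x by (simp add: hausdorff_covers_def d_def)
    then show "y \<in> ball (x i) (2 * d i)" using d[of i] by simp
  qed
  then have "(\<Union>i. U i) \<subseteq> (\<Union>i\<in>UNIV. ball (x i) (2 * d i))" by (rule UN_mono[OF order_refl])
  moreover have "cantor_square \<subseteq> (\<Union>i. U i)" using U by (simp add: hausdorff_covers_def)
  ultimately have "cantor_square \<subseteq> (\<Union>i\<in>UNIV. ball (x i) (2 * d i))" by (rule order_trans[rotated])
  then obtain I where I: "finite I" "cantor_square \<subseteq> (\<Union>i\<in>I. ball (x i) (2 * d i))"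
    by (rule compactE_image[OF compact_cantor_square, rotated]) auto
  obtain N where N: "\<And>i. i \<in> I \<Longrightarrow> 1 / 3 ^ N \<le> 4 * d i"
  proof -
    define m where "m = Min (insert 1 ((\<lambda>i. 4 * d i) ` I))"
    have "0 < m" using I(1) d by (simp add: m_def)
    then obtain N where "(1 / 3) ^ N < m" using real_arch_pow_inv[of m "1 / 3"] by auto
    moreover have "m \<le> 4 * d i" if "i \<in> I" for i
      using that I(1) by (simp add: m_def)
    ultimately show thesis by (intro that[of N]) (force simp: power_one_over)
  qed
  have "3 powr (- t) \<le> (\<Sum>i\<in>I. (4 * d i) powr t)"
  proof (rule cantor_square_finite_cover[OF t I(1) I(2), of N])
    fix i y z assume "i \<in> I" "y \<in> ball (x i) (2 * d i)" "z \<in> ball (x i) (2 * d i)"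
    then show "dist y z \<le> 4 * d i" using dist_triangle3[of y z "x i"] by simp
  qed (use N in auto)
  also have "\<dots> = 4 powr t * (\<Sum>i\<in>I. d i powr t)"
    using d by (simp add: powr_mult less_imp_le sum_distrib_left)
  finally have "12 powr (- t) \<le> (\<Sum>i\<in>I. d i powr t)"
    using powr_mult[of 3 4 "t"] by (simp add: powr_minus field_simps)
  then have "ennreal (12 powr (- t)) \<le> (\<Sum>i\<in>I. ennreal (d i powr t))"
    by (simp add: ennreal_leI)
  also have "\<dots> \<le> (\<Sum>i. ennreal (d i powr t))" using I(1) by (intro sum_le_suminf) auto
  finally show "ennreal (12 powr (- t)) \<le> (\<Sum>i. ennreal (diameter (U i) powr t))"
    by (simp add: d_def)
qed

lemma cantor_square_measure_nonzero:
  assumes "0 \<le> t" "3 powr t \<le> (4::real)"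
  shows "hausdorff_measure t cantor_square \<noteq> 0"
proof -
  have "0 < ennreal (12 powr (- t))" by simp
  also have "\<dots> \<le> hausdorff_premeasure t 1 cantor_square"
    by (rule cantor_square_premeasure_ge[OF assms])
  also have "\<dots> \<le> hausdorff_measure t cantor_square"
    unfolding hausdorff_measure_eq_SUP by (rule SUP_upper) simp
  finally show ?thesis by simp
qed

section \<open>Refining the mesh\<close>

lemma cantor_square_premeasure_refine:
  "hausdorff_premeasure t (\<delta> / 3) cantor_square
    \<le> ennreal (4 / 3 powr t) * hausdorff_premeasure t \<delta> cantor_square"
proof -
  let ?P = "hausdorff_premeasure t (\<delta> / 3)" and ?c = "ennreal (1 / 3 powr t)"
  let ?Q = "hausdorff_premeasure t \<delta> cantor_square"
  have cell: "?P (third_map c ` cantor_square) \<le> ?c * ?Q" for c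
    using hausdorff_premeasure_similarity_image[of "third_map c" "1 / 3", OF dist_third_map, of t \<delta>]
    by (simp add: powr_divide)
  have "?P cantor_square \<le> ?P (third_map (0, 0) ` cantor_square \<union> third_map (0, 2) ` cantor_square \<union>
      (third_map (2, 0) ` cantor_square \<union> third_map (2, 2) ` cantor_square))"
    using cantor_square_subset_third_maps by (intro hausdorff_premeasure_mono) auto
  also have "\<dots> \<le> (?P (third_map (0, 0) ` cantor_square) + ?P (third_map (0, 2) ` cantor_square)) +
      (?P (third_map (2, 0) ` cantor_square) + ?P (third_map (2, 2) ` cantor_square))"
    by (intro order_trans[OF hausdorff_premeasure_Un] add_mono hausdorff_premeasure_Un)
  also have "\<dots> \<le> (?c * ?Q + ?c * ?Q) + (?c * ?Q + ?c * ?Q)" by (intro add_mono cell)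
  also have "\<dots> = (?c + ?c + (?c + ?c)) * ?Q" by (simp add: distrib_right)
  also have "?c + ?c + (?c + ?c) = ennreal (4 / 3 powr t)"
    by (simp flip: ennreal_plus)
  finally show ?thesis .
qed

lemma cantor_square_premeasure_refine_power:
  "hausdorff_premeasure t (\<delta> / 3 ^ n) cantor_square
    \<le> ennreal ((4 / 3 powr t) ^ n) * hausdorff_premeasure t \<delta> cantor_square"
proof (induction n)
  case (Suc n)
  have "hausdorff_premeasure t (\<delta> / 3 ^ Suc n) cantor_square
      \<le> ennreal (4 / 3 powr t) * hausdorff_premeasure t (\<delta> / 3 ^ n) cantor_square"
    using cantor_square_premeasure_refine[of t "\<delta> / 3 ^ n"]
    by (simp only: divide_divide_eq_left power_Suc2)
  also have "\<dots> \<le> ennreal (4 / 3 powr t) *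
      (ennreal ((4 / 3 powr t) ^ n) * hausdorff_premeasure t \<delta> cantor_square)"
    by (intro mult_left_mono Suc.IH) simp
  also have "\<dots> = ennreal ((4 / 3 powr t) ^ Suc n) * hausdorff_premeasure t \<delta> cantor_square"
    by (simp only: power_Suc ennreal_mult' zero_le_divide_iff powr_ge_zero zero_le_numeral simp_thms mult.assoc)
  finally show ?case .
qed simp

lemma cantor_square_measure_le_premeasure:
  assumes "3 powr t = (4::real)" "0 < \<delta>"
  shows "hausdorff_measure t cantor_square \<le> hausdorff_premeasure t \<delta> cantor_square"
  unfolding hausdorff_measure_eq_SUP
proof (rule SUP_least)
  fix e :: real assume "e \<in> {0<..}"
  then obtain n where "(1 / 3) ^ n < e / \<delta>"
    using real_arch_pow_inv[of "e / \<delta>" "1 / 3"] \<open>0 < \<delta>\<close> by auto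
  then have "\<delta> / 3 ^ n \<le> e" using \<open>0 < \<delta>\<close> by (simp add: field_simps power_one_over)
  then have "hausdorff_premeasure t e cantor_square \<le> hausdorff_premeasure t (\<delta> / 3 ^ n) cantor_square"
    by (rule hausdorff_premeasure_antimono)
  also have "\<dots> \<le> hausdorff_premeasure t \<delta> cantor_square"
    using cantor_square_premeasure_refine_power[of t \<delta> n] assms by simp
  finally show "hausdorff_premeasure t e cantor_square \<le> hausdorff_premeasure t \<delta> cantor_square" .
qed

text \<open>The premeasure at mesh \<open>2\<close> is finite because the unit square itself is an admissible set.\<close>

lemma cantor_square_premeasure_finite:
  assumes "t > 0"
  shows "hausdorff_premeasure t 2 cantor_square < top"
proof -
  let ?Q = "cbox (0, 0) (1, 1) :: (real \<times> real) set"
  have diam: "diameter ?Q = sqrt 2"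
    by (subst diameter_cbox) (auto simp: Basis_prod_def dist_prod_def dist_real_def)
  have "sqrt 2 \<le> 2" by (rule real_le_lsqrt) auto
  have "cantor_square \<subseteq> ?Q" using cantor_set_subset by (auto simp: cbox_Pair_eq)
  then have "hausdorff_premeasure t 2 cantor_square \<le> hausdorff_premeasure t 2 ?Q"
    by (rule hausdorff_premeasure_mono)
  also have "\<dots> \<le> ennreal (diameter ?Q powr t)"
    using assms \<open>sqrt 2 \<le> 2\<close> by (intro hausdorff_premeasure_le_diameter) (auto simp: diam)
  also have "\<dots> < top" by simp
  finally show ?thesis .
qed

lemma cantor_square_measure_zero:
  assumes "t > 0" "3 powr t > (4::real)"
  shows "hausdorff_measure t cantor_square = 0"
proof -
  have "hausdorff_premeasure t e cantor_square \<le> 0" if "e > 0" for e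
  proof (rule tendsto_lowerbound)
    define M where "M = enn2real (hausdorff_premeasure t 2 cantor_square)"
    have M: "hausdorff_premeasure t 2 cantor_square = ennreal M"
      using cantor_square_premeasure_finite[OF assms(1)] by (simp add: M_def)
    have "(\<lambda>n. (4 / 3 powr t) ^ n * M) \<longlonglongrightarrow> 0 * M"
      using assms by (intro tendsto_intros LIMSEQ_realpow_zero) auto
    then show "(\<lambda>n. ennreal ((4 / 3 powr t) ^ n * M)) \<longlonglongrightarrow> 0"
      by (metis mult_zero_left tendsto_ennrealI ennreal_0)
    have "(\<lambda>n. 2 * (1 / 3) ^ n :: real) \<longlonglongrightarrow> 2 * 0"
      by (intro tendsto_intros LIMSEQ_realpow_zero) auto
    then have "\<forall>\<^sub>F n in sequentially. 2 * (1 / 3) ^ n < e"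
      using \<open>e > 0\<close> order_tendstoD(2) by fastforce
    then show "\<forall>\<^sub>F n in sequentially.
        hausdorff_premeasure t e cantor_square \<le> ennreal ((4 / 3 powr t) ^ n * M)"
    proof eventually_elim
      case (elim n)
      then have "hausdorff_premeasure t e cantor_square \<le> hausdorff_premeasure t (2 / 3 ^ n) cantor_square"
        by (intro hausdorff_premeasure_antimono) (simp add: power_one_over)
      also have "\<dots> \<le> ennreal ((4 / 3 powr t) ^ n * M)"
        using cantor_square_premeasure_refine_power[of t 2 n] by (simp add: M ennreal_mult')
      finally show ?case .
    qed
  qed simp
  then have "hausdorff_measure t cantor_square \<le> 0"
    unfolding hausdorff_measure_eq_SUP by (intro SUP_least) auto
  then show ?thesis by simp
qed

lemma hausdorff_dim_cantor_square: "hausdorff_dim cantor_square = ereal (log 3 4)"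
proof (rule antisym)
  have "log 3 4 > (0::real)" by simp
  show "hausdorff_dim cantor_square \<le> ereal (log 3 4)"
  proof (rule ereal_le_epsilon2)
    fix e :: real assume "0 < e"
    let ?t = "log 3 4 + e"
    have "3 powr ?t > (4::real)"
      using powr_less_mono[of "log 3 4" ?t 3] \<open>0 < e\<close> by simp
    then have "hausdorff_measure ?t cantor_square = 0"
      by (rule cantor_square_measure_zero[OF add_pos_pos[OF \<open>log 3 4 > 0\<close> \<open>0 < e\<close>]])
    then have "hausdorff_dim cantor_square \<le> ereal ?t"
      unfolding hausdorff_dim_def using add_pos_pos[OF \<open>log 3 4 > 0\<close> \<open>0 < e\<close>]
      by (intro INF_lower) auto
    then show "hausdorff_dim cantor_square \<le> ereal (log 3 4) + ereal e" by simp
  qed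
  show "ereal (log 3 4) \<le> hausdorff_dim cantor_square"
    unfolding hausdorff_dim_def
  proof (rule INF_greatest)
    fix t assume t: "t \<in> {t. 0 \<le> t \<and> hausdorff_measure t cantor_square = 0}"
    have "log 3 4 \<le> t"
    proof (rule ccontr)
      assume "\<not> log 3 4 \<le> t"
      then have "3 powr t \<le> (4::real)" using powr_mono[of t "log 3 4" 3] by simp
      with t show False using cantor_square_measure_nonzero by blast
    qed
    then show "ereal (log 3 4) \<le> ereal t" by simp
  qed
qed

section \<open>Covering by an octagon and small copies\<close>

text \<open>
  The cut \<open>20/243 = 2/27 + 2/243\<close> is the least value of \<open>x + y\<close> on \<open>C \<times> C\<close> once three cells are
  removed: the cell of side \<open>1/27\<close> at the origin and those of side \<open>1/243\<close> at \<open>(2/27, 0)\<close> and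
  \<open>(0, 2/27)\<close>.
\<close>

definition octagon :: "(real \<times> real) set" where
  "octagon = {(x, y). x \<in> {0..1} \<and> y \<in> {0..1} \<and>
     20 / 243 \<le> x + y \<and> x + y \<le> 2 - 20 / 243 \<and>
     x - y \<le> 1 - 20 / 243 \<and> y - x \<le> 1 - 20 / 243}"

text \<open>
  A convex function on the region cut out of the unit square by \<open>a + b \<le> 1 + k\<close> is largest at an
  extreme point, here \<open>(1, k)\<close> or \<open>(k, 1)\<close>.
\<close>

lemma sum_squares_le_extreme_point:
  fixes a b k :: real
  assumes "0 \<le> a" "a \<le> 1" "0 \<le> b" "b \<le> 1" "0 \<le> k" "a + b \<le> 1 + k"
  shows "a\<^sup>2 + b\<^sup>2 \<le> 1 + k\<^sup>2"
proof (cases "a + b \<le> 1")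
  case True
  have "a\<^sup>2 \<le> a" "b\<^sup>2 \<le> b"
    using assms by (auto simp: power2_eq_square mult_left_le)
  then have "a\<^sup>2 + b\<^sup>2 \<le> 1" using True by linarith
  also have "\<dots> \<le> 1 + k\<^sup>2" by simp
  finally show ?thesis .
next
  case False
  have "0 \<le> (1 - a) * (1 - b)" using assms by simp
  then have "a\<^sup>2 + b\<^sup>2 \<le> 1 + (a + b - 1)\<^sup>2"
    by (simp add: power2_eq_square algebra_simps)
  also have "(a + b - 1)\<^sup>2 \<le> k\<^sup>2" using False assms by (intro power_mono) auto
  finally show ?thesis by simp
qed

lemma octagon_dist_le:
  assumes "p \<in> octagon" "q \<in> octagon"
  shows "dist p q \<le> sqrt (1 + (203 / 243)\<^sup>2)"
proof -
  obtain x y x' y' where pq: "p = (x, y)" "q = (x', y')" by (metis surj_pair)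
  have "0 \<le> x" "x \<le> 1" "0 \<le> y" "y \<le> 1" "20 / 243 \<le> x + y" "x + y \<le> 2 - 20 / 243"
      "x - y \<le> 1 - 20 / 243" "y - x \<le> 1 - 20 / 243"
      "0 \<le> x'" "x' \<le> 1" "0 \<le> y'" "y' \<le> 1" "20 / 243 \<le> x' + y'" "x' + y' \<le> 2 - 20 / 243"
      "x' - y' \<le> 1 - 20 / 243" "y' - x' \<le> 1 - 20 / 243"
    using assms unfolding octagon_def pq by auto
  then have "\<bar>x - x'\<bar> \<le> 1" "\<bar>y - y'\<bar> \<le> 1" "\<bar>x - x'\<bar> + \<bar>y - y'\<bar> \<le> 1 + 203 / 243"
    by linarith+
  then have "\<bar>x - x'\<bar>\<^sup>2 + \<bar>y - y'\<bar>\<^sup>2 \<le> 1 + (203 / 243)\<^sup>2"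
    by (intro sum_squares_le_extreme_point) auto
  then show ?thesis by (simp add: pq dist_Pair_Pair dist_real_def)
qed

lemma bounded_octagon: "bounded octagon"
  by (rule bounded_subset[OF bounded_cbox[of "(0, 0)" "(1, 1)"]]) (auto simp: octagon_def cbox_Pair_eq)

lemma octagon_diameter_le: "diameter octagon \<le> sqrt (1 + (203 / 243)\<^sup>2)"
  by (rule diameter_le) (use octagon_dist_le in \<open>auto simp: dist_norm octagon_def\<close>)

lemma octagon_diameter_pos: "0 < diameter octagon"
proof -
  have "dist (0 :: real, 1 / 2 :: real) (1, 1 / 2) \<le> diameter octagon"
    by (intro diameter_bounded_bound bounded_octagon) (auto simp: octagon_def)
  then show ?thesis by (simp add: dist_prod_def dist_real_def)
qed

definition low_corner :: "(real \<times> real) set" where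
  "low_corner = {p \<in> cantor_square. fst p + snd p < 20 / 243}"

definition scaled_copy :: "real \<Rightarrow> real \<times> real \<Rightarrow> real \<times> real \<Rightarrow> real \<times> real" where
  "scaled_copy r v p = v + r *\<^sub>R p"

lemma dist_scaled_copy: "0 \<le> r \<Longrightarrow> dist (scaled_copy r v p) (scaled_copy r v q) = r * dist p q"
  by (simp add: scaled_copy_def dist_norm flip: scaleR_diff_right)

text \<open>
  The cell of side \<open>1/27\<close> at the origin is one piece. A point outside it has a coordinate of at
  least \<open>2/27 = 18/243\<close>, which leaves less than \<open>2/243\<close> for the other coordinate and for the
  excess; both then lie in a first cell of level five.
\<close>

lemma low_corner_subset:
  "low_corner \<subseteq> scaled_copy (1 / 27) 0 ` cantor_square \<union>
    (scaled_copy (1 / 243) (2 / 27, 0) ` cantor_square \<union> scaled_copy (1 / 243) (0, 2 / 27) ` cantor_square)"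
proof
  have far: "243 * x - 18 \<in> cantor_set \<and> 243 * y \<in> cantor_set"
    if "x \<in> cantor_set" "y \<in> cantor_set" "9 * x \<in> cantor_set" "2 / 3 \<le> 9 * x" "x + y < 20 / 243" for x y
  proof -
    have "0 \<le> y" using that(2) cantor_set_subset by auto
    from that(3) have "3 * (9 * x) - 2 \<in> cantor_set"
      by (cases rule: cantor_set_cases) (use that in auto)
    then have "(27 * x - 2) * 3 ^ 2 \<in> cantor_set"
      using that \<open>0 \<le> y\<close> by (intro cantor_set_zoom) auto
    moreover have "y * 3 ^ 5 \<in> cantor_set"
      using that by (intro cantor_set_zoom) auto
    ultimately show ?thesis by (simp add: algebra_simps)
  qed
  fix p assume "p \<in> low_corner"
  then obtain x y where p: "p = (x, y)" and xy: "x \<in> cantor_set" "y \<in> cantor_set" "x + y < 20 / 243"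
    by (auto simp: low_corner_def)
  have nonneg: "0 \<le> x" "0 \<le> y" using xy cantor_set_subset by auto
  have nine: "9 * x \<in> cantor_set" "9 * y \<in> cantor_set"
    using cantor_set_zoom[OF xy(1), of 2] cantor_set_zoom[OF xy(2), of 2] xy(3) nonneg
    by (auto simp: mult.commute)
  consider "9 * x < 2 / 3" "9 * y < 2 / 3" | "2 / 3 \<le> 9 * x" | "2 / 3 \<le> 9 * y" by linarith
  then show "p \<in> scaled_copy (1 / 27) 0 ` cantor_square \<union>
    (scaled_copy (1 / 243) (2 / 27, 0) ` cantor_square \<union> scaled_copy (1 / 243) (0, 2 / 27) ` cantor_square)"
  proof cases
    case 1
    then have "27 * x \<in> cantor_set" "27 * y \<in> cantor_set"
      using cantor_set_zoom[OF xy(1), of 3] cantor_set_zoom[OF xy(2), of 3] by (auto simp: mult.commute)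
    then have "p \<in> scaled_copy (1 / 27) 0 ` cantor_square"
      by (intro image_eqI[of _ _ "(27 * x, 27 * y)"]) (auto simp: p scaled_copy_def field_simps)
    then show ?thesis by blast
  next
    case 2
    from far[OF xy(1,2) nine(1) this xy(3)]
    have "p \<in> scaled_copy (1 / 243) (2 / 27, 0) ` cantor_square"
      by (intro image_eqI[of _ _ "(243 * x - 18, 243 * y)"]) (auto simp: p scaled_copy_def field_simps)
    then show ?thesis by blast
  next
    case 3
    have "y + x < 20 / 243" using xy(3) by simp
    from far[OF xy(2,1) nine(2) 3 this]
    have "p \<in> scaled_copy (1 / 243) (0, 2 / 27) ` cantor_square"
      by (intro image_eqI[of _ _ "(243 * x, 243 * y - 18)"]) (auto simp: p scaled_copy_def field_simps)
    then show ?thesis by blast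
  qed
qed

lemma low_corner_premeasure_le:
  assumes "0 \<le> \<delta>"
  shows "hausdorff_premeasure (log 3 4) \<delta> low_corner
    \<le> ennreal (9 / 512) * hausdorff_premeasure (log 3 4) \<delta> cantor_square"
proof -
  let ?s = "log 3 4 :: real"
  let ?P = "hausdorff_premeasure ?s \<delta>"
  have ratio: "(1 / 3 ^ n) powr ?s = 1 / 4 ^ n" for n :: nat
  proof -
    have "(3 ^ n) powr ?s = (3 powr ?s) powr real n"
      by (simp only: powr_powr mult.commute powr_realpow[symmetric] zero_less_numeral)
    then show ?thesis by (simp add: powr_divide powr_realpow)
  qed
  have copy: "?P (scaled_copy (1 / 3 ^ n) v ` cantor_square) \<le> ennreal (1 / 4 ^ n) * ?P cantor_square"
    for n v
    using hausdorff_premeasure_contraction_image[of "scaled_copy (1 / 3 ^ n) v" "1 / 3 ^ n" \<delta> ?s cantor_square]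
      assms unfolding ratio by (simp add: dist_scaled_copy)
  have "?P low_corner \<le> ?P (scaled_copy (1 / 27) 0 ` cantor_square) +
      (?P (scaled_copy (1 / 243) (2 / 27, 0) ` cantor_square) +
       ?P (scaled_copy (1 / 243) (0, 2 / 27) ` cantor_square))"
    by (intro order_trans[OF hausdorff_premeasure_mono[OF low_corner_subset]]
      order_trans[OF hausdorff_premeasure_Un] add_left_mono hausdorff_premeasure_Un)
  also have "\<dots> \<le> ennreal (1 / 64) * ?P cantor_square +
      (ennreal (1 / 1024) * ?P cantor_square + ennreal (1 / 1024) * ?P cantor_square)"
    using copy[of 3] copy[of 5] by (intro add_mono) auto
  also have "\<dots> = (ennreal (1 / 64) + (ennreal (1 / 1024) + ennreal (1 / 1024))) * ?P cantor_square"
    by (simp only: distrib_right)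
  also have "ennreal (1 / 64) + (ennreal (1 / 1024) + ennreal (1 / 1024)) = ennreal (9 / 512)"
    by (simp flip: ennreal_plus)
  finally show ?thesis .
qed

text \<open>The reflections carry the lower left corner to the other three.\<close>

lemma cantor_square_subset_octagon_corners:
  "cantor_square \<subseteq> octagon \<union> ((low_corner \<union> (\<lambda>(x, y). (1 - x, y)) ` low_corner) \<union>
    ((\<lambda>(x, y). (x, 1 - y)) ` low_corner \<union> (\<lambda>(x, y). (1 - x, 1 - y)) ` low_corner))"
proof
  fix p assume "p \<in> cantor_square"
  then obtain x y where p: "p = (x, y)" and xy: "x \<in> cantor_set" "y \<in> cantor_set" by auto
  have refl: "1 - x \<in> cantor_set" "1 - y \<in> cantor_set" using xy cantor_set_reflect by auto
  have unit: "x \<in> {0..1}" "y \<in> {0..1}" using xy cantor_set_subset by auto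
  consider "p \<in> octagon" | "(x, y) \<in> low_corner" | "(1 - x, y) \<in> low_corner"
    | "(x, 1 - y) \<in> low_corner" | "(1 - x, 1 - y) \<in> low_corner"
  proof -
    have "p \<in> octagon \<or> x + y < 20 / 243 \<or> (1 - x) + y < 20 / 243 \<or>
        x + (1 - y) < 20 / 243 \<or> (1 - x) + (1 - y) < 20 / 243"
      using unit unfolding octagon_def p by auto
    then show thesis using that xy refl unfolding low_corner_def by auto
  qed
  then show "p \<in> octagon \<union> ((low_corner \<union> (\<lambda>(x, y). (1 - x, y)) ` low_corner) \<union>
    ((\<lambda>(x, y). (x, 1 - y)) ` low_corner \<union> (\<lambda>(x, y). (1 - x, 1 - y)) ` low_corner))"
    by cases (force simp: p)+
qed

text \<open>
  Since \<open>2\<^sup>1\<^sup>9 \<le> 3\<^sup>1\<^sup>2\<close>, the exponent \<open>log\<^sub>3 2\<close> is at most \<open>12/19\<close>, and the estimate becomes an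
  inequality between integer powers of rationals.
\<close>

lemma octagon_diameter_powr_le: "diameter octagon powr log 3 4 \<le> 1.504975 * (119 / 128)"
proof -
  define X where "X = 1 + (203 / 243 :: real)\<^sup>2"
  \<comment> \<open>a short decimal just below \<open>1.504975 * (119 / 128)\<close>, which keeps the powers small\<close>
  define B where "B = (1.399 :: real)"
  have "1 \<le> X" "0 < B" by (simp_all add: X_def B_def)
  have "ln ((2::real) ^ 19) \<le> ln (3 ^ 12)" by (subst ln_le_cancel_iff) auto
  then have "19 * ln 2 \<le> 12 * ln (3::real)"
    by (simp only: ln_realpow of_nat_numeral)
  then have le: "ln 2 / ln 3 \<le> 12 / (19::real)" by (simp add: field_simps)
  have half: "log 3 4 / 2 = ln 2 / ln (3::real)"
    using ln_realpow[of 2 2] by (simp add: log_def)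
  have "diameter octagon powr log 3 4 \<le> sqrt X powr log 3 4"
    using octagon_diameter_le octagon_diameter_pos by (intro powr_mono2) (auto simp: X_def)
  also have "\<dots> = X powr (log 3 4 / 2)"
    using \<open>1 \<le> X\<close> by (simp add: powr_half_sqrt[symmetric] powr_powr)
  also have "\<dots> \<le> X powr (12 / 19)"
    unfolding half using le \<open>1 \<le> X\<close> by (intro powr_mono)
  also have "\<dots> = (X ^ 12) powr (1 / 19)"
    using \<open>1 \<le> X\<close> powr_powr[of X 12 "1 / 19"] by simp
  also have "\<dots> \<le> (B ^ 19) powr (1 / 19)"
  proof (rule powr_mono2)
    have "X ^ 12 \<le> 1.698 ^ 12"
      by (rule power_mono) (simp_all add: X_def power2_eq_square)
    also have "\<dots> \<le> B ^ 19" by (simp add: B_def power_divide)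
    finally show "X ^ 12 \<le> B ^ 19" .
  qed (use \<open>1 \<le> X\<close> in auto)
  also have "\<dots> = B"
    using \<open>0 < B\<close> powr_powr[of B 19 "1 / 19"] by simp
  also have "\<dots> \<le> 1.504975 * (119 / 128)" by (simp add: B_def)
  finally show ?thesis .
qed

lemma cantor_square_premeasure_le:
  "hausdorff_premeasure (log 3 4) 2 cantor_square \<le> ennreal 1.504975"
proof -
  let ?P = "hausdorff_premeasure (log 3 4) 2"
  define M where "M = enn2real (?P cantor_square)"
  have M: "?P cantor_square = ennreal M" "0 \<le> M"
    using cantor_square_premeasure_finite[of "log 3 4"] by (auto simp: M_def)
  have low: "?P low_corner \<le> ennreal (9 / 512 * M)"
    using low_corner_premeasure_le[of 2] M by (simp add: ennreal_mult' del: times_divide_eq_left)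
  have refl: "?P (f ` low_corner) \<le> ennreal (9 / 512 * M)"
    if "\<And>p q. dist (f p) (f q) = dist p q" for f :: "real \<times> real \<Rightarrow> real \<times> real"
    using hausdorff_premeasure_contraction_image[of f 1 2 "log 3 4" low_corner] that low by simp
  have "1 + (203 / 243)\<^sup>2 \<le> (2::real)\<^sup>2" by (simp add: power_divide)
  then have "sqrt (1 + (203 / 243)\<^sup>2) \<le> 2" by (intro real_le_lsqrt) auto
  with octagon_diameter_le have "diameter octagon \<le> 2" by (rule order_trans)
  then have "?P octagon \<le> ennreal (diameter octagon powr log 3 4)"
    using bounded_octagon octagon_diameter_pos by (intro hausdorff_premeasure_le_diameter) auto
  also have "\<dots> \<le> ennreal (1.504975 * (119 / 128))"
    using octagon_diameter_powr_le by (rule ennreal_leI)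
  finally have oct: "?P octagon \<le> ennreal (1.504975 * (119 / 128))" .
  have "ennreal M \<le> ?P (octagon \<union> ((low_corner \<union> (\<lambda>(x, y). (1 - x, y)) ` low_corner) \<union>
    ((\<lambda>(x, y). (x, 1 - y)) ` low_corner \<union> (\<lambda>(x, y). (1 - x, 1 - y)) ` low_corner)))"
    unfolding M(1)[symmetric]
    by (rule hausdorff_premeasure_mono[OF cantor_square_subset_octagon_corners])
  also have "\<dots> \<le> ?P octagon + ((?P low_corner + ?P ((\<lambda>(x, y). (1 - x, y)) ` low_corner)) +
    (?P ((\<lambda>(x, y). (x, 1 - y)) ` low_corner) + ?P ((\<lambda>(x, y). (1 - x, 1 - y)) ` low_corner)))"
    by (intro order_trans[OF hausdorff_premeasure_Un] add_mono hausdorff_premeasure_Un order_refl)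
  also have "\<dots> \<le> ennreal (1.504975 * (119 / 128)) +
    ((ennreal (9 / 512 * M) + ennreal (9 / 512 * M)) + (ennreal (9 / 512 * M) + ennreal (9 / 512 * M)))"
    by (intro add_mono oct low refl) (auto simp: dist_prod_def dist_real_def power2_commute)
  also have "\<dots> = ennreal (1.504975 * (119 / 128) + 9 / 128 * M)"
    using M(2) by (simp flip: ennreal_plus)
  finally have "M \<le> 1.504975 * (119 / 128) + 9 / 128 * M"
    using M(2) by (subst (asm) ennreal_le_iff) auto
  then have "M \<le> 1.504975" by simp
  then show ?thesis unfolding M(1) by (rule ennreal_leI)
qed

theorem theorem2:
  fixes s :: real
  assumes "s = log 3 4"
  shows "hausdorff_dim (cantor_set \<times> cantor_set) = ereal s \<and>
         hausdorff_measure s (cantor_set \<times> cantor_set) \<le> ennreal 1.504975"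
proof
  show "hausdorff_dim cantor_square = ereal s"
    unfolding assms by (rule hausdorff_dim_cantor_square)
  have "hausdorff_measure s cantor_square \<le> hausdorff_premeasure s 2 cantor_square"
    by (rule cantor_square_measure_le_premeasure) (simp_all add: assms)
  also have "\<dots> \<le> ennreal 1.504975"
    unfolding assms by (rule cantor_square_premeasure_le)
  finally show "hausdorff_measure s cantor_square \<le> ennreal 1.504975" .
qed

end
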